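(* Let $n\ge 2$. The characteristic polynomial of the Laplacian matrix of the enhanced power graph $\mathcal{P}_e(SD_{8n})$ of the semidihedral group $SD_{8n}$ is \[\Phi(L(\mathcal{P}_e(SD_{8n})),x)=x(x-8n)(x-6n)(x-4n)^{4n-3}(x-2)^{n}(x-4)^{n}(x-1)^{2n}.\]
   Context: For $n\ge 2$, the semidihedral group of order $8n$ is $SD_{8n}=\langle a,b : a^{4n}=b^2=e,\ ba=a^{2n-1}b\rangle$. The enhanced power graph $\mathcal{P}_e(G)$ of a finite group $G$ is the simple undirected graph with vertex set $G$ in which two distinct vertices $x,y$ are adjacent if and only if $x,y\in\langle z\rangle$ for some $z\in G$. The Laplacian matrix of a finite simple graph $\Gamma$ is $L(\Gamma)=D(\Gamma)-A(\Gamma)$, where $A(\Gamma)$ is the adjacency matrix and $D(\Gamma)$ the diagonal matrix of vertex degrees. $\Phi(L(\Gamma),x)=\det(xI-L(\Gamma))$ is its characteristic polynomial. *)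

theory Defs
  imports
    "HOL-Number_Theory.Cong"
    "HOL-Algebra.Generated_Groups"
    "Graph_Theory.Pair_Digraph"
    "Jordan_Normal_Form.Char_Poly"
begin

section \<open>Groups given by generators and relations\<close>

text \<open>A word is a list of letters; \<open>(g, True)\<close> stands for the generator \<open>g\<close> and
  \<open>(g, False)\<close> for its formal inverse. A relation \<open>u = v\<close> is the pair \<open>(u, v)\<close>.\<close>

type_synonym 'g word = "('g \<times> bool) list"

inductive pres_eq :: "('g word \<times> 'g word) set \<Rightarrow> 'g word \<Rightarrow> 'g word \<Rightarrow> bool"
  for R :: "('g word \<times> 'g word) set" where
  refl: "pres_eq R w w"
| sym: "pres_eq R u v \<Longrightarrow> pres_eq R v u"
| trans: "pres_eq R u v \<Longrightarrow> pres_eq R v w \<Longrightarrow> pres_eq R u w"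
| cancel: "pres_eq R (u @ [(g, s), (g, \<not> s)] @ v) (u @ v)"
| relation: "(l, r) \<in> R \<Longrightarrow> pres_eq R (u @ l @ v) (u @ r @ v)"

definition word_class :: "('g word \<times> 'g word) set \<Rightarrow> 'g word \<Rightarrow> 'g word set" where
  "word_class R w = {v. pres_eq R w v}"

text \<open>The group \<open>\<langle>'g : R\<rangle>\<close>, generated by all elements of the type \<open>'g\<close>.\<close>

definition presented_group :: "('g word \<times> 'g word) set \<Rightarrow> 'g word set monoid" where
  "presented_group R = \<lparr>
     carrier = range (word_class R),
     mult = (\<lambda>X Y. \<Union>x\<in>X. \<Union>y\<in>Y. word_class R (x @ y)),
     one = word_class R [] \<rparr>"

lemma word_class_eq_iff: "word_class R u = word_class R v \<longleftrightarrow> pres_eq R u v"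
  unfolding word_class_def by (auto intro: pres_eq.refl pres_eq.sym pres_eq.trans)

lemma pres_eq_context:
  assumes "pres_eq R u v" shows "pres_eq R (p @ u @ q) (p @ v @ q)"
  using assms
proof induction
  case (cancel u g s v)
  show ?case using pres_eq.cancel[of R "p @ u" g s "v @ q"] by simp
next
  case (relation l r u v)
  then show ?case using pres_eq.relation[of l r R "p @ u" "v @ q"] by simp
qed (auto intro: pres_eq.refl pres_eq.sym pres_eq.trans)

lemma pres_eq_append:
  assumes "pres_eq R u u'" "pres_eq R v v'" shows "pres_eq R (u @ v) (u' @ v')"
  using pres_eq_context[OF assms(1), of "[]" v] pres_eq_context[OF assms(2), of u' "[]"]
  by (auto intro: pres_eq.trans)

lemma carrier_presented_group: "carrier (presented_group R) = range (word_class R)"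
  by (simp add: presented_group_def)

lemma one_presented_group: "\<one>\<^bsub>presented_group R\<^esub> = word_class R []"
  by (simp add: presented_group_def)

lemma mult_presented_group:
  "word_class R u \<otimes>\<^bsub>presented_group R\<^esub> word_class R v = word_class R (u @ v)"
proof -
  have "word_class R (x @ y) = word_class R (u @ v)"
    if "x \<in> word_class R u" "y \<in> word_class R v" for x y
    using that unfolding word_class_eq_iff
    by (auto simp: word_class_def intro: pres_eq.sym pres_eq_append)
  moreover have "u \<in> word_class R u" "v \<in> word_class R v"
    by (auto simp: word_class_def intro: pres_eq.refl)
  ultimately have "(\<Union>x\<in>word_class R u. \<Union>y\<in>word_class R v. word_class R (x @ y))
      = word_class R (u @ v)" by blast
  then show ?thesis by (simp add: presented_group_def)
qed

lemma pres_eq_inverse_left: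
  "pres_eq R (rev (map (\<lambda>(g, s). (g, \<not> s)) w) @ w) []"
proof (induction w)
  case (Cons a w)
  obtain g s where a: "a = (g, s)" by force
  have "pres_eq R (rev (map (\<lambda>(g, s). (g, \<not> s)) (a # w)) @ a # w)
      (rev (map (\<lambda>(g, s). (g, \<not> s)) w) @ w)"
    using pres_eq.cancel[of R "rev (map (\<lambda>(g, s). (g, \<not> s)) w)" g "\<not> s" w] by (simp add: a)
  then show ?case using Cons.IH by (rule pres_eq.trans)
qed (simp add: pres_eq.refl)

lemma group_presented_group: "group (presented_group R)"
proof (rule groupI)
  fix x assume "x \<in> carrier (presented_group R)"
  then obtain w where w: "x = word_class R w" by (auto simp: carrier_presented_group)
  have "word_class R (rev (map (\<lambda>(g, s). (g, \<not> s)) w)) \<otimes>\<^bsub>presented_group R\<^esub> x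
      = \<one>\<^bsub>presented_group R\<^esub>"
    unfolding w mult_presented_group one_presented_group word_class_eq_iff
    by (rule pres_eq_inverse_left)
  then show "\<exists>y\<in>carrier (presented_group R).
      y \<otimes>\<^bsub>presented_group R\<^esub> x = \<one>\<^bsub>presented_group R\<^esub>"
    by (auto simp: carrier_presented_group)
qed (auto simp: carrier_presented_group mult_presented_group one_presented_group)


section \<open>The semidihedral group\<close>

datatype sd_gen = Gen_a | Gen_b

abbreviation a_pow :: "nat \<Rightarrow> sd_gen word" where
  "a_pow k \<equiv> replicate k (Gen_a, True)"

abbreviation b_pow :: "nat \<Rightarrow> sd_gen word" where
  "b_pow k \<equiv> replicate k (Gen_b, True)"

definition SD_relations :: "nat \<Rightarrow> (sd_gen word \<times> sd_gen word) set" where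
  "SD_relations n =
     {(a_pow (4 * n), []),
      (b_pow 2, []),
      (b_pow 1 @ a_pow 1, a_pow (2 * n - 1) @ b_pow 1)}"

text \<open>The index is \<open>n\<close>, not the order \<open>8 * n\<close>.\<close>

definition SD :: "nat \<Rightarrow> sd_gen word set monoid" where
  "SD n = presented_group (SD_relations n)"

lemma group_SD: "group (SD n)"
  unfolding SD_def by (rule group_presented_group)

text \<open>To see that \<open>SD n\<close> does not collapse, let words act on pairs \<open>(i, j)\<close>, which represent
  \<open>a\<^sup>i b\<^sup>j\<close> with \<open>i\<close> read modulo \<open>4 * n\<close>, by left multiplication.\<close>

fun sd_act :: "nat \<Rightarrow> sd_gen \<times> bool \<Rightarrow> int \<times> bool \<Rightarrow> int \<times> bool" where
  "sd_act n (Gen_a, s) (i, j) = (if s then i + 1 else i - 1, j)"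
| "sd_act n (Gen_b, s) (i, j) = ((2 * int n - 1) * i, \<not> j)"

definition sd_equiv :: "nat \<Rightarrow> int \<times> bool \<Rightarrow> int \<times> bool \<Rightarrow> bool" where
  "sd_equiv n x y \<longleftrightarrow> [fst x = fst y] (mod 4 * int n) \<and> snd x = snd y"

lemma sd_equiv_trans: "sd_equiv n x y \<Longrightarrow> sd_equiv n y z \<Longrightarrow> sd_equiv n x z"
  by (auto simp: sd_equiv_def intro: cong_trans)

lemma sd_equiv_act: "sd_equiv n x y \<Longrightarrow> sd_equiv n (sd_act n l x) (sd_act n l y)"
  by (cases x; cases y; cases "(n, l, x)" rule: sd_act.cases)
    (auto simp: sd_equiv_def intro: cong_add cong_diff cong_mult)

lemma sd_equiv_foldr:
  "sd_equiv n x y \<Longrightarrow> sd_equiv n (foldr (sd_act n) w x) (foldr (sd_act n) w y)"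
  by (induction w) (auto intro: sd_equiv_act)

lemma funpow_sd_act: "(sd_act n (Gen_a, True) ^^ k) x = (fst x + int k, snd x)"
  by (induction k) (cases x, auto)+

lemma sd_square: "[(2 * int n - 1) * ((2 * int n - 1) * i) = i] (mod 4 * int n)"
proof -
  have "(2 * int n - 1) * ((2 * int n - 1) * i) - i = 4 * int n * ((int n - 1) * i)"
    by (simp add: algebra_simps)
  then show ?thesis by (simp add: cong_iff_dvd_diff)
qed

lemma sd_equiv_invariant:
  assumes "pres_eq (SD_relations n) u v" "n \<ge> 1"
  shows "sd_equiv n (foldr (sd_act n) u x) (foldr (sd_act n) v x)"
  using assms
proof (induction arbitrary: x)
  case (refl w) show ?case by (simp add: sd_equiv_def)
next
  case (sym u v) then show ?case by (simp add: sd_equiv_def cong_sym_eq)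
next
  case (trans u v w) then show ?case by (blast intro: sd_equiv_trans)
next
  case (cancel u g s v)
  have "sd_equiv n (sd_act n (g, s) (sd_act n (g, \<not> s) y)) y" for y
    by (cases y; cases g) (auto simp: sd_equiv_def sd_square)
  from sd_equiv_foldr[OF this, of u "foldr (sd_act n) v x"] show ?case by simp
next
  case (relation l r u v)
  have "sd_equiv n (foldr (sd_act n) l y) (foldr (sd_act n) r y)" for y
    using relation
    by (cases y) (auto simp: SD_relations_def funpow_sd_act sd_equiv_def sd_square
        cong_iff_dvd_diff numeral_2_eq_2 algebra_simps of_nat_diff)
  from sd_equiv_foldr[OF this, of u "foldr (sd_act n) v x"] show ?case by simp
qed

lemma pres_eq_a_pow_mod:
  "pres_eq (SD_relations n) (a_pow k @ v) (a_pow (k mod (4 * n)) @ v)"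
proof (induction k rule: less_induct)
  case (less k)
  show ?case
  proof (cases "n > 0 \<and> k \<ge> 4 * n")
    case True
    then have *: "a_pow k = a_pow (4 * n) @ a_pow (k - 4 * n)"
      by (simp flip: replicate_add)
    have "pres_eq (SD_relations n) (a_pow k @ v) (a_pow (k - 4 * n) @ v)"
      using pres_eq.relation[of "a_pow (4 * n)" "[]" "SD_relations n" "[]" "a_pow (k - 4 * n) @ v"]
      by (simp add: SD_relations_def *)
    with less.IH[of "k - 4 * n"] True show ?thesis
      by (auto simp: mod_if[of k] intro: pres_eq.trans)
  next
    case False
    then show ?thesis by (cases "n = 0") (auto simp: pres_eq.refl)
  qed
qed

lemma pres_eq_b_a_pow:
  "pres_eq (SD_relations n) (b_pow 1 @ a_pow k @ v) (a_pow ((2 * n - 1) * k) @ b_pow 1 @ v)"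
proof (induction k arbitrary: v)
  case (Suc k)
  have "pres_eq (SD_relations n) (b_pow 1 @ a_pow (Suc k) @ v)
      (a_pow (2 * n - 1) @ b_pow 1 @ a_pow k @ v)"
    using pres_eq.relation[of "b_pow 1 @ a_pow 1" "a_pow (2 * n - 1) @ b_pow 1" "SD_relations n"
        "[]" "a_pow k @ v"]
    by (simp add: SD_relations_def)
  moreover have "pres_eq (SD_relations n) (a_pow (2 * n - 1) @ b_pow 1 @ a_pow k @ v)
      (a_pow (2 * n - 1) @ a_pow ((2 * n - 1) * k) @ b_pow 1 @ v)"
    by (intro pres_eq_append pres_eq.refl Suc.IH)
  ultimately show ?case by (auto simp: replicate_add intro: pres_eq.trans)
qed (simp add: pres_eq.refl)

lemma pres_eq_normal_form:
  assumes "n \<ge> 1"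
  shows "\<exists>i j. pres_eq (SD_relations n) w (a_pow i @ b_pow (if j then 1 else 0))"
proof (induction w)
  case Nil
  show ?case by (intro exI[of _ 0] exI[of _ False]) (simp add: pres_eq.refl)
next
  case (Cons l w)
  let ?R = "SD_relations n" and ?b = "\<lambda>j. b_pow (if j then 1 else 0)"
  obtain i j where ij: "pres_eq ?R w (a_pow i @ ?b j)" using Cons.IH by blast
  have w: "pres_eq ?R (l # w) ([l] @ a_pow i @ ?b j)"
    using pres_eq_append[OF pres_eq.refl[of _ "[l]"] ij] by simp
  consider "l = (Gen_a, True)" | "l = (Gen_a, False)" | s where "l = (Gen_b, s)"
    by (cases l; cases "fst l"; cases "snd l") auto
  then show ?case
  proof cases
    case 1
    then have "[l] @ a_pow i @ ?b j = a_pow (Suc i) @ ?b j" by simp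
    with w show ?thesis by metis
  next
    case 2
    have a: "a_pow (i + 4 * n) = (Gen_a, True) # a_pow (i + 4 * n - 1)"
      using assms by (simp flip: replicate_Suc)
    have "pres_eq ?R (a_pow i @ ?b j) (a_pow (i + 4 * n) @ ?b j)"
      by (rule pres_eq.trans[OF pres_eq_a_pow_mod[of n i]])
        (rule pres_eq.sym[OF pres_eq_a_pow_mod[of n "i + 4 * n", unfolded mod_add_self2]])
    then have "pres_eq ?R ([l] @ a_pow i @ ?b j) ([l] @ a_pow (i + 4 * n) @ ?b j)"
      by (rule pres_eq_append[OF pres_eq.refl])
    moreover have "pres_eq ?R ([l] @ a_pow (i + 4 * n) @ ?b j) (a_pow (i + 4 * n - 1) @ ?b j)"
      using pres_eq.cancel[of ?R "[]" Gen_a False "a_pow (i + 4 * n - 1) @ ?b j"]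
      by (simp only: 2 a) simp
    ultimately show ?thesis using w by (blast intro: pres_eq.trans)
  next
    case 3
    have bb: "pres_eq ?R (b_pow 2) []"
      using pres_eq.relation[of "b_pow 2" "[]" ?R "[]" "[]"] by (simp add: SD_relations_def)
    have l: "pres_eq ?R [l] (b_pow 1)"
    proof (cases s)
      case False
      have "pres_eq ?R ([l] @ b_pow 2) ([l] @ [])"
        by (intro pres_eq_append pres_eq.refl bb)
      moreover have "pres_eq ?R ([l] @ b_pow 2) (b_pow 1)"
        using pres_eq.cancel[of ?R "[]" Gen_b False "b_pow 1"]
        by (simp add: 3 False numeral_2_eq_2)
      ultimately show ?thesis by (auto intro: pres_eq.trans pres_eq.sym)
    qed (simp add: 3 pres_eq.refl)
    have "pres_eq ?R (l # w) (b_pow 1 @ a_pow i @ ?b j)"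
      using pres_eq_append[OF l ij] by simp
    then have "pres_eq ?R (l # w) (a_pow ((2 * n - 1) * i) @ b_pow 1 @ ?b j)"
      by (rule pres_eq.trans) (rule pres_eq_b_a_pow)
    moreover have "pres_eq ?R (b_pow 1 @ ?b j) (?b (\<not> j))"
      using bb by (cases j) (auto simp: numeral_2_eq_2 intro: pres_eq.refl)
    ultimately have "pres_eq ?R (l # w) (a_pow ((2 * n - 1) * i) @ ?b (\<not> j))"
      by (meson pres_eq.trans pres_eq_append pres_eq.refl)
    then show ?thesis by blast
  qed
qed

lemma order_SD:
  assumes "n \<ge> 1" shows "Coset.order (SD n) = 8 * n"
proof -
  let ?R = "SD_relations n" and ?b = "\<lambda>j. b_pow (if j then 1 else 0)"
  let ?f = "\<lambda>(i, j). word_class ?R (a_pow i @ ?b j)"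
  have inj: "i = i' \<and> j = j'"
    if ii': "i < 4 * n" "i' < 4 * n"
      and eq: "word_class ?R (a_pow i @ ?b j) = word_class ?R (a_pow i' @ ?b j')"
    for i i' j j'
  proof -
    have *: "foldr (sd_act n) (a_pow k @ ?b m) (0, False) = (int k, m)"
      for k :: nat and m :: bool
      by (simp add: funpow_sd_act)
    have "sd_equiv n (int i, j) (int i', j')"
      using sd_equiv_invariant[OF eq[unfolded word_class_eq_iff] assms, of "(0, False)"]
      by (simp only: *)
    then have "[i = i'] (mod 4 * n)" "j = j'"
      by (auto simp: sd_equiv_def simp flip: cong_int_iff)
    then show "i = i' \<and> j = j'" using ii' by (simp add: cong_less_modulus_unique_nat)
  qed
  have "inj_on ?f ({..<4 * n} \<times> UNIV)"
  proof (rule inj_onI)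
    fix p q :: "nat \<times> bool"
    assume "p \<in> {..<4 * n} \<times> UNIV" "q \<in> {..<4 * n} \<times> UNIV" "?f p = ?f q"
    then show "p = q"
      using inj[of "fst p" "fst q" "snd p" "snd q"] by (simp add: case_prod_beta mem_Times_iff prod_eq_iff)
  qed
  moreover have "?f ` ({..<4 * n} \<times> UNIV) = carrier (SD n)"
  proof -
    have "word_class ?R w \<in> ?f ` ({..<4 * n} \<times> UNIV)" for w
    proof -
      obtain i j where "pres_eq ?R w (a_pow i @ ?b j)"
        using pres_eq_normal_form[OF assms] by blast
      then have "pres_eq ?R w (a_pow (i mod (4 * n)) @ ?b j)"
        by (rule pres_eq.trans) (rule pres_eq_a_pow_mod)
      then have "word_class ?R w = ?f (i mod (4 * n), j)" by (simp add: word_class_eq_iff)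
      then show ?thesis by (rule image_eqI) (use assms in simp)
    qed
    then show ?thesis by (auto simp: SD_def carrier_presented_group)
  qed
  ultimately have "card (carrier (SD n)) = card ({..<4 * n} \<times> (UNIV :: bool set))"
    by (metis card_image)
  then show ?thesis by (simp add: Coset.order_def)
qed


corollary finite_SD: "n \<ge> 1 \<Longrightarrow> finite (carrier (SD n))"
  using order_SD[of n] by (intro card_ge_0_finite) (simp add: Coset.order_def)


section \<open>The enhanced power graph\<close>

text \<open>A simple undirected graph is a finite, symmetric, loop-free set of ordered pairs
  (the locale \<open>pair_graph\<close>).\<close>

definition enhanced_power_graph :: "('a, 'm) monoid_scheme \<Rightarrow> 'a pair_pre_digraph" where
  "enhanced_power_graph G = \<lparr>
     pverts = carrier G,
     parcs = {(x, y). x \<in> carrier G \<and> y \<in> carrier G \<and> x \<noteq> y \<and>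
                (\<exists>z\<in>carrier G. x \<in> generate G {z} \<and> y \<in> generate G {z})} \<rparr>"

lemma pair_graph_enhanced_power_graph:
  assumes "finite (carrier G)" shows "pair_graph (enhanced_power_graph G)"
proof
  show "finite (parcs (enhanced_power_graph G))"
    by (rule finite_subset[of _ "carrier G \<times> carrier G"])
      (use assms in \<open>auto simp: enhanced_power_graph_def\<close>)
qed (use assms in \<open>auto simp: enhanced_power_graph_def symmetric_def intro!: symI\<close>)


section \<open>The Laplacian matrix\<close>

text \<open>Rows and columns are indexed along an enumeration \<open>vs\<close> of the vertices.\<close>

definition adjacency_matrix :: "'v pair_pre_digraph \<Rightarrow> 'v list \<Rightarrow> real mat" where
  "adjacency_matrix \<Gamma> vs = mat (length vs) (length vs)
     (\<lambda>(i, j). if (vs ! i, vs ! j) \<in> parcs \<Gamma> then 1 else 0)"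

definition degree_matrix :: "'v pair_pre_digraph \<Rightarrow> 'v list \<Rightarrow> real mat" where
  "degree_matrix \<Gamma> vs = mat (length vs) (length vs)
     (\<lambda>(i, j). if i = j then real (out_degree (with_proj \<Gamma>) (vs ! i)) else 0)"

definition laplacian_matrix :: "'v pair_pre_digraph \<Rightarrow> 'v list \<Rightarrow> real mat" where
  "laplacian_matrix \<Gamma> vs = degree_matrix \<Gamma> vs - adjacency_matrix \<Gamma> vs"

end

theory Submission
  imports Defs "HOL-Algebra.Multiplicative_Group"
begin

text \<open>Write the elements of the group as \<open>a\<^sup>i b\<^sup>j\<close> with \<open>i < 4 * n\<close>. Since
  \<open>(a\<^sup>i b)\<^sup>2 = a\<^bsup>2 n i\<^esup>\<close>, a reflection \<open>a\<^sup>i b\<close> with \<open>i\<close> even is an involution, whereas for odd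
  \<open>i\<close> it has order four and generates \<open>{e, a\<^sup>i b, c, a\<^bsup>i + 2 n\<^esup> b}\<close>, where \<open>c = a\<^bsup>2 n\<^esup>\<close>. Every other
  cyclic subgroup consists of rotations and lies in \<open>\<langle>a\<rangle>\<close>. So the enhanced power graph is a
  clique on the \<open>4 * n\<close> rotations, together with \<open>2 * n\<close> pendant vertices (the even reflections)
  attached to \<open>e\<close>, and \<open>n\<close> edges (the pairs of odd reflections) both of whose ends are joined to
  \<open>e\<close> and to \<open>c\<close> (\<open>common_cyclic_iff_sd_joined\<close>).

  The Laplacian of this graph becomes triangular in a very sparse basis. Write \<open>\<delta>\<^sub>x\<close> for the
  indicator function of a vertex, \<open>P\<close> for the set of even reflections, \<open>w\<close> and \<open>u\<close> for the two
  members of a pair of odd reflections, \<open>k\<close> for a rotation other than \<open>e\<close>, \<open>c\<close> and \<open>a\<close>, and \<open>\<one>\<close>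
  for the constant function. Then

  \<^item> \<open>L \<one> = 0\<close>
  \<^item> \<open>L \<delta>\<^sub>e = 8 n \<delta>\<^sub>e - \<one>\<close>
  \<^item> \<open>L \<delta>\<^sub>p = \<delta>\<^sub>p - \<delta>\<^sub>e\<close> for \<open>p \<in> P\<close>
  \<^item> \<open>L \<delta>\<^sub>c = 6 n \<delta>\<^sub>c + (\<Sum>p\<in>P. \<delta>\<^sub>p) - \<one>\<close>
  \<^item> \<open>L (\<delta>\<^sub>w + \<delta>\<^sub>u) = 2 (\<delta>\<^sub>w + \<delta>\<^sub>u) - 2 \<delta>\<^sub>c - 2 \<delta>\<^sub>e\<close>
  \<^item> \<open>L \<delta>\<^sub>u = 4 \<delta>\<^sub>u - (\<delta>\<^sub>w + \<delta>\<^sub>u) - \<delta>\<^sub>c - \<delta>\<^sub>e\<close>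
  \<^item> \<open>L \<delta>\<^sub>k = 4 n \<delta>\<^sub>k + (\<Sum>p\<in>P. \<delta>\<^sub>p) + (\<Sum>w. \<delta>\<^sub>w + \<delta>\<^sub>u) - \<one>\<close>

  and each right-hand side involves only functions from this line and the lines above it. These
  functions form a basis: they are the indicator functions with \<open>\<delta>\<^sub>a\<close> replaced by \<open>\<one>\<close> and each
  \<open>\<delta>\<^sub>w\<close> by \<open>\<delta>\<^sub>w + \<delta>\<^sub>u\<close>. Hence the characteristic polynomial is the product of the linear factors
  of the diagonal entries (\<open>char_poly_triangular_basis\<close>), and counting the vertices of each kind gives
  the multiplicities (\<open>prod_sd_eigenvalue\<close>).\<close>

section \<open>Characteristic polynomials from a triangularising basis\<close>

lemma sum_nth_distinct:
  assumes "distinct xs"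
  shows "(\<Sum>k<length xs. f (xs ! k)) = sum f (set xs)"
  by (rule sum.reindex_bij_betw[OF bij_betw_nth[OF assms HOL.refl HOL.refl]])

text \<open>The columns of \<open>B\<close> are a basis, with inverse \<open>C\<close>, in which \<open>L\<close> acts by \<open>T\<close>. Because everything
  is indexed by elements and not by positions, the order that makes \<open>T\<close> triangular (by \<open>r\<close>) can
  differ from the order \<open>xs\<close> that is used to write down the matrix of \<open>L\<close>. Elements of equal rank
  come in any order, which is why \<open>T\<close> has to be diagonal on them.\<close>

lemma char_poly_triangular_basis:
  fixes L B C T :: "'v \<Rightarrow> 'v \<Rightarrow> 'a :: field" and r :: "'v \<Rightarrow> nat"
  assumes dist: "distinct xs"
    and BC: "\<And>x y. x \<in> set xs \<Longrightarrow> y \<in> set xs \<Longrightarrow>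
      (\<Sum>z\<in>set xs. B x z * C z y) = (if x = y then 1 else 0)"
    and LB: "\<And>x y. x \<in> set xs \<Longrightarrow> y \<in> set xs \<Longrightarrow>
      (\<Sum>z\<in>set xs. L x z * B z y) = (\<Sum>z\<in>set xs. B x z * T z y)"
    and T: "\<And>x y. x \<in> set xs \<Longrightarrow> y \<in> set xs \<Longrightarrow> T x y \<noteq> 0 \<Longrightarrow> x = y \<or> r x < r y"
  shows "char_poly (mat (length xs) (length xs) (\<lambda>(p, q). L (xs ! p) (xs ! q)))
    = (\<Prod>x\<in>set xs. [:- T x x, 1:])"
proof -
  define ys where "ys = sort_key r xs"
  define N where "N = length xs"
  have ys: "set ys = set xs" "distinct ys" "length ys = N" "sorted (map r ys)"
    by (simp_all add: ys_def N_def dist)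
  have xs_in: "xs ! p \<in> set xs" "ys ! p \<in> set xs" if "p < N" for p
    using that ys by (metis N_def nth_mem)+
  have sums: "(\<Sum>k = 0..<N. f (xs ! k)) = sum f (set xs)" "(\<Sum>k = 0..<N. f (ys ! k)) = sum f (set xs)"
    for f :: "'v \<Rightarrow> 'a"
    using sum_nth_distinct[OF dist, of f] sum_nth_distinct[OF ys(2), of f]
    by (simp_all add: ys N_def atLeast0LessThan)
  define Lm where "Lm = mat N N (\<lambda>(p, q). L (xs ! p) (xs ! q))"
  \<comment> \<open>The rows of the change of basis follow \<open>xs\<close> and its columns the sorted list \<open>ys\<close>, so
    conjugation with it also performs the reordering.\<close>
  define Bm where "Bm = mat N N (\<lambda>(p, q). B (xs ! p) (ys ! q))"
  define Cm where "Cm = mat N N (\<lambda>(p, q). C (ys ! p) (xs ! q))"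
  define Tm where "Tm = mat N N (\<lambda>(p, q). T (ys ! p) (ys ! q))"
  note defs = Lm_def Bm_def Cm_def Tm_def
  have carr: "Lm \<in> carrier_mat N N" "Bm \<in> carrier_mat N N" "Cm \<in> carrier_mat N N"
    "Tm \<in> carrier_mat N N" by (simp_all add: defs)
  have BC': "Bm * Cm = 1\<^sub>m N"
  proof (rule eq_matI)
    fix p q assume "p < dim_row (1\<^sub>m N :: 'a mat)" "q < dim_col (1\<^sub>m N :: 'a mat)"
    then have pq: "p < N" "q < N" by auto
    have "(Bm * Cm) $$ (p, q) = (\<Sum>k = 0..<N. B (xs ! p) (ys ! k) * C (ys ! k) (xs ! q))"
      using pq by (simp add: defs scalar_prod_def)
    also have "\<dots> = (if xs ! p = xs ! q then 1 else 0)"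
      using sums(2)[of "\<lambda>z. B (xs ! p) z * C z (xs ! q)"] BC xs_in pq by simp
    also have "\<dots> = 1\<^sub>m N $$ (p, q)"
      using pq dist by (simp add: N_def nth_eq_iff_index_eq)
    finally show "(Bm * Cm) $$ (p, q) = 1\<^sub>m N $$ (p, q)" .
  qed (simp_all add: defs)
  then have CB: "Cm * Bm = 1\<^sub>m N"
    by (rule mat_mult_left_right_inverse[OF carr(2,3)])
  have LB': "Lm * Bm = Bm * Tm"
  proof (rule eq_matI)
    fix p q assume "p < dim_row (Bm * Tm)" "q < dim_col (Bm * Tm)"
    then have pq: "p < N" "q < N" by (auto simp: defs)
    have "(Lm * Bm) $$ (p, q) = (\<Sum>k = 0..<N. L (xs ! p) (xs ! k) * B (xs ! k) (ys ! q))"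
      using pq by (simp add: defs scalar_prod_def)
    also have "\<dots> = (\<Sum>k = 0..<N. B (xs ! p) (ys ! k) * T (ys ! k) (ys ! q))"
      using sums(1)[of "\<lambda>z. L (xs ! p) z * B z (ys ! q)"]
        sums(2)[of "\<lambda>z. B (xs ! p) z * T z (ys ! q)"] LB xs_in pq by simp
    also have "\<dots> = (Bm * Tm) $$ (p, q)"
      using pq by (simp add: defs scalar_prod_def)
    finally show "(Lm * Bm) $$ (p, q) = (Bm * Tm) $$ (p, q)" .
  qed (simp_all add: defs)
  have "Bm * Tm * Cm = Lm * (Bm * Cm)"
    unfolding LB'[symmetric] by (rule assoc_mult_mat[OF carr(1,2,3)])
  also have "\<dots> = Lm" using carr by (simp add: BC')
  finally have "Lm = Bm * Tm * Cm" by (rule HOL.sym)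
  with BC' CB have "similar_mat_wit Lm Tm Bm Cm"
    by (rule similar_mat_witI) (rule carr(1) carr(4) carr(2) carr(3))+
  then have "similar_mat Lm Tm" unfolding similar_mat_def by blast
  then have "char_poly Lm = char_poly Tm" by (rule char_poly_similar)
  also have "upper_triangular Tm"
    unfolding upper_triangular_def
  proof (intro allI impI)
    fix p q assume "p < dim_row Tm" "q < p"
    then have pq: "q < p" "p < N" by (auto simp: defs)
    then have "r (ys ! q) \<le> r (ys ! p)" "ys ! p \<noteq> ys ! q"
      using ys sorted_nth_mono[of "map r ys" q p] by (auto simp: nth_eq_iff_index_eq)
    then have "T (ys ! p) (ys ! q) = 0"
      using T[of "ys ! p" "ys ! q"] xs_in pq by force
    then show "Tm $$ (p, q) = 0" using pq by (simp add: Tm_def)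
  qed
  then have "char_poly Tm = (\<Prod>a\<leftarrow>diag_mat Tm. [:- a, 1:])"
    by (rule char_poly_upper_triangular[OF carr(4)])
  also have "diag_mat Tm = map (\<lambda>x. T x x) ys"
    by (rule nth_equalityI) (simp_all add: diag_mat_def Tm_def ys)
  also have "(\<Prod>a\<leftarrow>map (\<lambda>x. T x x) ys. [:- a, 1:]) = (\<Prod>x\<in>set xs. [:- T x x, 1:])"
    using prod.distinct_set_conv_list[OF ys(2), of "\<lambda>x. [:- T x x, 1:]"] by (simp add: ys(1) comp_def)
  finally show ?thesis by (simp add: Lm_def N_def)
qed

section \<open>Cyclic subgroups of the semidihedral group\<close>

text \<open>Pairs \<open>(i, j)\<close> stand for \<open>a\<^sup>i b\<^sup>j\<close>. All exponents \<open>i\<close> are accepted, which keeps products free of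
  reductions modulo \<open>4 * n\<close>; the reduced pairs are those in \<open>sd_index\<close>.\<close>

definition sd_elt :: "nat \<Rightarrow> nat \<times> bool \<Rightarrow> sd_gen word set" where
  "sd_elt n x = word_class (SD_relations n) (a_pow (fst x) @ b_pow (if snd x then 1 else 0))"

definition sd_index :: "nat \<Rightarrow> (nat \<times> bool) set" where
  "sd_index n = {..<4 * n} \<times> UNIV"

lemma sd_elt_eq_iff:
  assumes "n \<ge> 1"
  shows "sd_elt n x = sd_elt n y \<longleftrightarrow> [fst x = fst y] (mod 4 * n) \<and> snd x = snd y"
proof
  assume eq: "sd_elt n x = sd_elt n y"
  have *: "foldr (sd_act n) (a_pow k @ b_pow (if m then 1 else 0)) (0, False) = (int k, m)"
    for k :: nat and m :: bool
    by (simp add: funpow_sd_act)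
  have "sd_equiv n (int (fst x), snd x) (int (fst y), snd y)"
    using sd_equiv_invariant[OF eq[unfolded sd_elt_def word_class_eq_iff] assms, of "(0, False)"]
    by (simp only: *)
  then show "[fst x = fst y] (mod 4 * n) \<and> snd x = snd y"
    by (auto simp: sd_equiv_def simp flip: cong_int_iff)
next
  assume "[fst x = fst y] (mod 4 * n) \<and> snd x = snd y"
  moreover have "sd_elt n z = sd_elt n (fst z mod (4 * n), snd z)" for z
    unfolding sd_elt_def word_class_eq_iff fst_conv snd_conv by (rule pres_eq_a_pow_mod)
  from this[of x] this[of y] calculation show "sd_elt n x = sd_elt n y"
    by (simp add: cong_def)
qed

lemma sd_elt_mod: "n \<ge> 1 \<Longrightarrow> sd_elt n (i mod (4 * n), j) = sd_elt n (i, j)"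
  by (simp add: sd_elt_eq_iff)

lemma bij_betw_sd_elt:
  assumes "n \<ge> 1"
  shows "bij_betw (sd_elt n) (sd_index n) (carrier (SD n))"
proof (rule bij_betw_imageI)
  show "inj_on (sd_elt n) (sd_index n)"
    using assms by (auto simp: inj_on_def sd_index_def sd_elt_eq_iff cong_less_modulus_unique_nat)
  have "word_class (SD_relations n) w \<in> sd_elt n ` sd_index n" for w
  proof -
    obtain i j where "pres_eq (SD_relations n) w (a_pow i @ b_pow (if j then 1 else 0))"
      using pres_eq_normal_form[OF assms] by blast
    then have "word_class (SD_relations n) w = sd_elt n (i mod (4 * n), j)"
      by (simp add: sd_elt_mod[OF assms]) (simp add: sd_elt_def word_class_eq_iff)
    moreover have "(i mod (4 * n), j) \<in> sd_index n" using assms by (simp add: sd_index_def)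
    ultimately show ?thesis by blast
  qed
  then show "sd_elt n ` sd_index n = carrier (SD n)"
    by (auto simp: SD_def carrier_presented_group sd_elt_def)
qed

lemma sd_elt_in_carrier [simp]: "sd_elt n x \<in> carrier (SD n)"
  by (simp add: SD_def carrier_presented_group sd_elt_def)

lemma one_SD: "\<one>\<^bsub>SD n\<^esub> = sd_elt n (0, False)"
  by (simp add: SD_def one_presented_group sd_elt_def)

text \<open>Moving \<open>b\<close> to the right past \<open>a\<close> multiplies the exponent of \<open>a\<close> by \<open>2 * n - 1\<close>.\<close>

lemma sd_elt_mult:
  "sd_elt n (i, j) \<otimes>\<^bsub>SD n\<^esub> sd_elt n (i', j')
    = sd_elt n (i + (if j then (2 * n - 1) * i' else i'), j \<noteq> j')"
proof -
  let ?R = "SD_relations n" and ?b = "\<lambda>j. b_pow (if j then 1 else 0)"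
  have "pres_eq ?R (a_pow i @ ?b j @ a_pow i' @ ?b j')
    (a_pow i @ a_pow (if j then (2 * n - 1) * i' else i') @ ?b j @ ?b j')"
    using pres_eq_b_a_pow[of n i' "?b j'"] by (cases j) (auto intro: pres_eq_append pres_eq.refl)
  moreover have "pres_eq ?R (?b j @ ?b j') (?b (j \<noteq> j'))"
    using pres_eq.relation[of "b_pow 2" "[]" ?R "[]" "[]"]
    by (cases j; cases j') (auto simp: SD_relations_def numeral_2_eq_2 intro: pres_eq.refl)
  ultimately have "pres_eq ?R (a_pow i @ ?b j @ a_pow i' @ ?b j')
    (a_pow i @ a_pow (if j then (2 * n - 1) * i' else i') @ ?b (j \<noteq> j'))"
    by (meson pres_eq.trans pres_eq_append pres_eq.refl)
  then show ?thesis
    by (simp add: SD_def sd_elt_def mult_presented_group word_class_eq_iff replicate_add)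
qed

lemma rotation_pow: "sd_elt n (i, False) [^]\<^bsub>SD n\<^esub> (k :: nat) = sd_elt n (i * k, False)"
proof -
  interpret group "SD n" by (rule group_SD)
  show ?thesis by (induction k) (simp_all add: one_SD sd_elt_mult add.commute)
qed

text \<open>The powers follow from \<open>(a\<^sup>i b)\<^sup>2 = a\<^bsup>i + (2 n - 1) i\<^esup> = a\<^bsup>2 n i\<^esup>\<close>.\<close>

lemma reflection_pow:
  assumes "n \<ge> 1"
  shows "sd_elt n (i, True) [^]\<^bsub>SD n\<^esub> (k :: nat)
    = sd_elt n (2 * n * i * (k div 2) + (if odd k then i else 0), odd k)"
proof -
  interpret group "SD n" by (rule group_SD)
  show ?thesis
  proof (induction k)
    case (Suc k)
    show ?case
    proof (cases "odd k")
      case True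
      have "2 * n * i * (k div 2) + i + (2 * n - 1) * i = 2 * n * i * Suc (k div 2)"
      proof -
        have "i + (2 * n - 1) * i = 2 * n * i"
          using assms by (simp add: algebra_simps)
        then show ?thesis by simp
      qed
      moreover have "sd_elt n (i, True) [^]\<^bsub>SD n\<^esub> Suc k
          = sd_elt n (2 * n * i * (k div 2) + i + (2 * n - 1) * i, False)"
        using True Suc by (simp add: sd_elt_mult)
      ultimately show ?thesis using True
        by (simp only: even_Suc odd_Suc_div_two if_False not_True_eq_False add_0_right simp_thms)
    qed (use Suc in \<open>simp add: sd_elt_mult\<close>)
  qed (simp add: one_SD)
qed

lemma generate_SD:
  assumes "n \<ge> 1" "z \<in> carrier (SD n)"
  shows "generate (SD n) {z} = range (\<lambda>k :: nat. z [^]\<^bsub>SD n\<^esub> k)"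
  using group.generate_pow_on_finite_carrier[OF group_SD finite_SD[OF assms(1)] assms(2)] by auto

text \<open>The square \<open>a\<^bsup>2 n i\<^esup>\<close> is trivial for even \<open>i\<close> and equals the involution \<open>a\<^bsup>2 n\<^esup>\<close> for odd \<open>i\<close>. So the
  first four powers already give the whole subgroup.\<close>

lemma generate_reflection:
  assumes n: "n \<ge> 1"
  shows "generate (SD n) {sd_elt n (i, True)} = {sd_elt n (0, False), sd_elt n (i, True)} \<union>
    (if odd i then {sd_elt n (2 * n, False), sd_elt n (i + 2 * n, True)} else {})"
    (is "_ = ?S")
proof -
  \<comment> \<open>Only the parity of \<open>i * m\<close> matters for \<open>a\<^bsup>2 n i m\<^esup>\<close>.\<close>
  have half: "sd_elt n (2 * n * i * m + l, s) = sd_elt n (if odd i \<and> odd m then l + 2 * n else l, s)"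
    for m l s
  proof -
    have "[2 * n * i * m + l = (if odd i \<and> odd m then l + 2 * n else l)] (mod 4 * n)"
    proof (cases "odd i \<and> odd m")
      case True
      then obtain t where t: "i * m = 2 * t + 1" by (metis even_mult_iff oddE)
      have "2 * n * i * m = 2 * n * (i * m)" by (simp only: ac_simps)
      also have "\<dots> = 4 * n * t + 2 * n" unfolding t by (simp add: algebra_simps)
      finally show ?thesis using True by (simp add: cong_def add.assoc add.commute[of l])
    next
      case False
      then obtain t where t: "i * m = 2 * t" by (metis even_mult_iff evenE)
      have "2 * n * i * m = 2 * n * (i * m)" by (simp only: ac_simps)
      also have "\<dots> = 4 * n * t" unfolding t by (simp add: algebra_simps)
      finally have "2 * n * i * m = 4 * n * t" .
      then have "(2 * n * i * m + l) mod (4 * n) = l mod (4 * n)" by (simp only: mod_mult_self4)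
      then show ?thesis unfolding cong_def if_not_P[OF False] .
    qed
    then show ?thesis using n by (simp add: sd_elt_eq_iff)
  qed
  have pow: "sd_elt n (i, True) [^]\<^bsub>SD n\<^esub> k = sd_elt n (if odd i \<and> odd (k div 2)
      then (if odd k then i else 0) + 2 * n else (if odd k then i else 0), odd k)" for k :: nat
    using half reflection_pow[OF n] by simp
  show ?thesis
    unfolding generate_SD[OF n sd_elt_in_carrier]
  proof (rule equalityI)
    show "range (\<lambda>k :: nat. sd_elt n (i, True) [^]\<^bsub>SD n\<^esub> k) \<subseteq> ?S"
    proof (rule image_subsetI)
      fix k :: nat
      show "sd_elt n (i, True) [^]\<^bsub>SD n\<^esub> k \<in> ?S"
        unfolding pow by (cases "odd i"; cases "odd (k div 2)"; cases "odd k") simp_all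
    qed
    have "?S \<subseteq> (\<lambda>k. sd_elt n (i, True) [^]\<^bsub>SD n\<^esub> k) ` {0 :: nat, 1, 2, 3}"
      by (simp add: pow)
    then show "?S \<subseteq> range (\<lambda>k :: nat. sd_elt n (i, True) [^]\<^bsub>SD n\<^esub> k)"
      by (rule subset_trans) (rule image_mono[OF subset_UNIV])
  qed
qed

lemma generate_rotation_subset:
  assumes "n \<ge> 1"
  shows "generate (SD n) {sd_elt n (i, False)} \<subseteq> range (\<lambda>k. sd_elt n (k, False))"
  by (auto simp: generate_SD[OF assms] rotation_pow)

text \<open>Equality or adjacency in the enhanced power graph. The reflexive version is used because
  "lying in a common cyclic subgroup" is reflexive, and because it turns the diagonal entry of the
  Laplacian into the size of a closed neighbourhood minus one.\<close>

definition sd_joined :: "nat \<Rightarrow> nat \<times> bool \<Rightarrow> nat \<times> bool \<Rightarrow> bool" where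
  "sd_joined n x y \<longleftrightarrow> x = y \<or> x = (0, False) \<or> y = (0, False) \<or> (\<not> snd x \<and> \<not> snd y)
    \<or> (x = (2 * n, False) \<and> odd (fst y)) \<or> (y = (2 * n, False) \<and> odd (fst x))
    \<or> (snd x \<and> snd y \<and> odd (fst x) \<and> (fst y = fst x + 2 * n \<or> fst x = fst y + 2 * n))"

lemma sd_joined_refl [simp]: "sd_joined n x x"
  by (simp add: sd_joined_def)

text \<open>The subgroups generated by \<open>a\<close> and by the reflections are enough: the subgroup generated by
  any rotation is contained in the one generated by \<open>a\<close>.\<close>

lemma common_cyclic_iff_sd_joined:
  assumes n: "n \<ge> 1" and x: "x \<in> sd_index n" and y: "y \<in> sd_index n"
  shows "(\<exists>z\<in>carrier (SD n). sd_elt n x \<in> generate (SD n) {z} \<and> sd_elt n y \<in> generate (SD n) {z})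
    \<longleftrightarrow> sd_joined n x y"
proof
  have red: "sd_elt n u = sd_elt n (v, s) \<longleftrightarrow> u = (v mod (4 * n), s)" if "u \<in> sd_index n" for u v s
    using that n by (cases u) (auto simp: sd_elt_eq_iff sd_index_def cong_def)
  assume "\<exists>z\<in>carrier (SD n). sd_elt n x \<in> generate (SD n) {z} \<and> sd_elt n y \<in> generate (SD n) {z}"
  then obtain i j where ij: "(i, j) \<in> sd_index n"
    "sd_elt n x \<in> generate (SD n) {sd_elt n (i, j)}" "sd_elt n y \<in> generate (SD n) {sd_elt n (i, j)}"
    using bij_betw_imp_surj_on[OF bij_betw_sd_elt[OF n]] by (metis imageE surj_pair)
  show "sd_joined n x y"
  proof (cases j)
    case False
    then have "sd_elt n x \<in> range (\<lambda>k. sd_elt n (k, False))"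
      "sd_elt n y \<in> range (\<lambda>k. sd_elt n (k, False))"
      using ij generate_rotation_subset[OF n, of i] by auto
    then have "\<not> snd x" "\<not> snd y" by (auto simp: red x y)
    then show ?thesis by (simp add: sd_joined_def)
  next
    case True
    \<comment> \<open>The exponent \<open>i + 2 * n\<close>, reduced modulo \<open>4 * n\<close>.\<close>
    define i' where "i' = (if i < 2 * n then i + 2 * n else i - 2 * n)"
    have "i < 4 * n" using ij(1) by (simp add: sd_index_def)
    then have "(i + 2 * n) mod (4 * n) = i'" "i mod (4 * n) = i"
      by (simp_all add: i'_def mod_if)
    moreover have "2 * n mod (4 * n) = 2 * n" using n by simp
    ultimately have "u = (0, False) \<or> u = (i, True) \<or> odd i \<and> (u = (2 * n, False) \<or> u = (i', True))"
      if "u \<in> sd_index n" "sd_elt n u \<in> generate (SD n) {sd_elt n (i, True)}" for u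
      using that by (auto simp: generate_reflection[OF n] red split: if_splits)
    from this[OF x] this[OF y]
    have "x = (0, False) \<or> x = (i, True) \<or> odd i \<and> (x = (2 * n, False) \<or> x = (i', True))"
      "y = (0, False) \<or> y = (i, True) \<or> odd i \<and> (y = (2 * n, False) \<or> y = (i', True))"
      using ij True by simp_all
    moreover have "i = i' + 2 * n \<or> i' = i + 2 * n" by (simp add: i'_def)
    ultimately show ?thesis by (elim disjE conjE) (simp_all add: sd_joined_def)
  qed
next
  assume "sd_joined n x y"
  let ?G = "SD n"
  have self: "sd_elt n u \<in> generate ?G {sd_elt n u}" for u by (simp add: generate.incl)
  have one: "sd_elt n (0, False) \<in> generate ?G {u}" for u
    unfolding one_SD[symmetric] by (rule generate.one)
  have rot: "sd_elt n (k, False) \<in> generate ?G {sd_elt n (1, False)}" for k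
    unfolding generate_SD[OF n sd_elt_in_carrier] using rotation_pow[of n 1 k]
    by (metis mult_1 rangeI)
  note refl = generate_reflection[OF n]
  consider "x = y \<or> y = (0, False)" | "x = (0, False)" | "\<not> snd x" "\<not> snd y"
    | i where "x = (2 * n, False)" "y = (i, True)" "odd i"
    | i where "y = (2 * n, False)" "x = (i, True)" "odd i"
    | i where "x = (i, True)" "y = (i + 2 * n, True)" "odd i"
    | i where "y = (i, True)" "x = (i + 2 * n, True)" "odd i"
    using \<open>sd_joined n x y\<close> by (cases x; cases y) (auto simp: sd_joined_def)
  then show "\<exists>z\<in>carrier ?G. sd_elt n x \<in> generate ?G {z} \<and> sd_elt n y \<in> generate ?G {z}"
  proof cases
    case 1 then show ?thesis using self[of x] one[of "sd_elt n x"] by (intro bexI[of _ "sd_elt n x"]) auto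
  next
    case 2 then show ?thesis using self[of y] one[of "sd_elt n y"] by (intro bexI[of _ "sd_elt n y"]) auto
  next
    case 3 then show ?thesis using rot
      by (cases x; cases y) (intro bexI[of _ "sd_elt n (1, False)"], auto)
  next
    case 4 then show ?thesis by (intro bexI[of _ "sd_elt n y"]) (auto simp: refl)
  next
    case 5 then show ?thesis by (intro bexI[of _ "sd_elt n x"]) (auto simp: refl)
  next
    case 6 then show ?thesis by (intro bexI[of _ "sd_elt n x"]) (auto simp: refl)
  next
    case 7 then show ?thesis by (intro bexI[of _ "sd_elt n y"]) (auto simp: refl)
  qed
qed

section \<open>The Laplacian in coordinates\<close>

definition sd_laplacian :: "nat \<Rightarrow> nat \<times> bool \<Rightarrow> nat \<times> bool \<Rightarrow> real" where
  "sd_laplacian n x y = (if x = y then real (card {z \<in> sd_index n. sd_joined n x z}) else 0)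
    - (if sd_joined n x y then 1 else 0)"

lemma finite_sd_index [simp]: "finite (sd_index n)"
  by (simp add: sd_index_def)

lemma sum_sd_laplacian:
  assumes "x \<in> sd_index n"
  shows "(\<Sum>z\<in>sd_index n. sd_laplacian n x z) = 0"
  using assms by (simp add: sd_laplacian_def sum_subtractf sum.If_cases Int_def)

lemma laplacian_matrix_SD:
  assumes n: "n \<ge> 1" and dist: "distinct xs" and xs: "set xs = sd_index n"
  shows "laplacian_matrix (enhanced_power_graph (SD n)) (map (sd_elt n) xs)
    = mat (length xs) (length xs) (\<lambda>(p, q). sd_laplacian n (xs ! p) (xs ! q))"
proof -
  let ?\<Gamma> = "enhanced_power_graph (SD n)"
  note bij = bij_betw_sd_elt[OF n]
  have inj: "sd_elt n x = sd_elt n y \<longleftrightarrow> x = y" if "x \<in> sd_index n" "y \<in> sd_index n" for x y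
    using bij that by (auto simp: bij_betw_def inj_on_eq_iff)
  have adj: "(sd_elt n x, sd_elt n y) \<in> parcs ?\<Gamma> \<longleftrightarrow> x \<noteq> y \<and> sd_joined n x y"
    if "x \<in> sd_index n" "y \<in> sd_index n" for x y
    using that common_cyclic_iff_sd_joined[OF n that] by (simp add: enhanced_power_graph_def inj)
  have deg: "real (out_degree (with_proj ?\<Gamma>) (sd_elt n x))
      = real (card {z \<in> sd_index n. sd_joined n x z}) - 1" if x: "x \<in> sd_index n" for x
  proof -
    let ?N = "{z \<in> sd_index n. sd_joined n x z}"
    have "out_arcs (with_proj ?\<Gamma>) (sd_elt n x) = (\<lambda>z. (sd_elt n x, sd_elt n z)) ` (?N - {x})"
    proof (intro equalityI subsetI)
      fix e assume "e \<in> out_arcs (with_proj ?\<Gamma>) (sd_elt n x)"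
      then obtain v where v: "e = (sd_elt n x, v)" "e \<in> parcs ?\<Gamma>"
        by (cases e) (auto simp: out_arcs_def)
      then have "v \<in> carrier (SD n)" by (simp add: enhanced_power_graph_def)
      then obtain z where "z \<in> sd_index n" "v = sd_elt n z"
        using bij_betw_imp_surj_on[OF bij] by blast
      then show "e \<in> (\<lambda>z. (sd_elt n x, sd_elt n z)) ` (?N - {x})"
        using v adj[OF x] by auto
    qed (use adj[OF x] in \<open>auto simp: out_arcs_def\<close>)
    moreover have "inj_on (\<lambda>z. (sd_elt n x, sd_elt n z)) (?N - {x})"
      by (auto simp: inj_on_def inj)
    ultimately have "out_degree (with_proj ?\<Gamma>) (sd_elt n x) = card (?N - {x})"
      by (simp add: out_degree_def card_image)
    moreover have "x \<in> ?N" using x by (simp add: sd_joined_def)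
    then have "card ?N = Suc (card (?N - {x}))" by (intro card.remove) simp_all
    ultimately show ?thesis by simp
  qed
  show ?thesis
  proof (rule eq_matI)
    fix p q
    assume "p < dim_row (mat (length xs) (length xs) (\<lambda>(p, q). sd_laplacian n (xs ! p) (xs ! q)))"
      "q < dim_col (mat (length xs) (length xs) (\<lambda>(p, q). sd_laplacian n (xs ! p) (xs ! q)))"
    then have pq: "p < length xs" "q < length xs" by auto
    then have mem: "xs ! p \<in> sd_index n" "xs ! q \<in> sd_index n" using xs nth_mem by blast+
    have "p = q \<longleftrightarrow> xs ! p = xs ! q" using dist pq by (simp add: nth_eq_iff_index_eq)
    then show "laplacian_matrix ?\<Gamma> (map (sd_elt n) xs) $$ (p, q)
      = mat (length xs) (length xs) (\<lambda>(p, q). sd_laplacian n (xs ! p) (xs ! q)) $$ (p, q)"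
      using pq adj[OF mem] deg[OF mem(1)]
      by (auto simp: laplacian_matrix_def degree_matrix_def adjacency_matrix_def sd_laplacian_def)
  qed (simp_all add: laplacian_matrix_def degree_matrix_def adjacency_matrix_def)
qed

lemma card_sd_joined:
  assumes "n \<ge> 2" "x \<in> sd_index n"
  shows "card {z \<in> sd_index n. sd_joined n x z} =
    (if x = (0, False) then 8 * n else if x = (2 * n, False) then 6 * n
     else if \<not> snd x then 4 * n else if odd (fst x) then 4 else 2)"
proof -
  let ?N = "{z \<in> sd_index n. sd_joined n x z}"
  let ?rot = "{..<4 * n} \<times> {False}" and ?odd = "(\<lambda>k. (2 * k + 1, True)) ` {..<2 * n}"
  have card: "card ?rot = 4 * n" "card ?odd = 2 * n"
    by (simp_all add: card_image inj_on_def card_cartesian_product)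
  obtain i j where x: "x = (i, j)" "i < 4 * n" using assms(2) by (auto simp: sd_index_def)
  consider "x = (0, False)" | "x = (2 * n, False)" | "\<not> j" "i \<noteq> 0" "i \<noteq> 2 * n"
    | "j" "odd i" "i < 2 * n" | "j" "odd i" "i \<ge> 2 * n" | "j" "even i"
    using x by (cases j; cases "odd i"; cases "i < 2 * n") auto
  then show ?thesis
  proof cases
    case 1
    then have "?N = sd_index n" by (auto simp: sd_joined_def)
    then show ?thesis using 1 by (simp add: sd_index_def card_cartesian_product)
  next
    case 2
    have "?N = ?rot \<union> ?odd"
      using 2 assms(1) by (auto simp: sd_joined_def sd_index_def elim!: oddE)
    moreover have "card (?rot \<union> ?odd) = card ?rot + card ?odd"
      by (rule card_Un_disjoint) auto
    ultimately show ?thesis using 2 card assms(1) by simp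
  next
    case 3
    then have "?N = ?rot" using x by (auto simp: sd_joined_def sd_index_def)
    then show ?thesis using 3 x card by simp
  next
    case 4
    then have "?N = {(0, False), (2 * n, False), (i, True), (i + 2 * n, True)}"
      using x by (auto simp: sd_joined_def sd_index_def)
    then show ?thesis using 4 x assms(1) by simp
  next
    case 5
    then have "?N = {(0, False), (2 * n, False), (i, True), (i - 2 * n, True)}"
      using x by (auto simp: sd_joined_def sd_index_def)
    then show ?thesis using 5 x assms(1) by auto
  next
    case 6
    then have "?N = {(0, False), (i, True)}"
      using x by (auto simp: sd_joined_def sd_index_def)
    then show ?thesis using 6 x by simp
  qed
qed

section \<open>A triangularising basis\<close>

text \<open>The rank is the position in the list of basis functions at the beginning: \<open>\<one>\<close> (which takes the
  place of the indicator function of \<open>a\<close>), \<open>e\<close>, the even reflections, \<open>c\<close>, the pairs, the second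
  members of the pairs, and the other rotations. In a pair \<open>{a\<^sup>i b, a\<^bsup>i + 2 n\<^esup> b}\<close> with \<open>i < 2 * n\<close> odd, \<open>a\<^sup>i b\<close> is the index
  of \<open>\<delta>\<^sub>w + \<delta>\<^sub>u\<close> and \<open>a\<^bsup>i + 2 n\<^esup> b\<close> that of \<open>\<delta>\<^sub>u\<close>.\<close>

definition sd_rank :: "nat \<Rightarrow> nat \<times> bool \<Rightarrow> nat" where
  "sd_rank n x = (if \<not> snd x
     then (if fst x = 1 then 0 else if fst x = 0 then 1 else if fst x = 2 * n then 3 else 6)
     else if even (fst x) then 2 else if fst x < 2 * n then 4 else 5)"

definition sd_eigenvalue :: "nat \<Rightarrow> nat \<Rightarrow> real" where
  "sd_eigenvalue n r = [0, 8 * real n, 1, 6 * real n, 2, 4, 4 * real n] ! r"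

text \<open>Meaningful for vertices of rank 5 only, which it maps to the other member of their pair.\<close>

definition sd_partner :: "nat \<Rightarrow> nat \<times> bool \<Rightarrow> nat \<times> bool" where
  "sd_partner n x = (fst x - 2 * n, True)"

text \<open>The value at \<open>x\<close> of the basis function that belongs to \<open>y\<close>.\<close>

definition sd_basis :: "nat \<Rightarrow> nat \<times> bool \<Rightarrow> nat \<times> bool \<Rightarrow> real" where
  "sd_basis n x y = (if x = y then 1 else 0) + (if x \<noteq> (1, False) \<and> y = (1, False) then 1 else 0)
    + (if sd_rank n x = 5 \<and> y = sd_partner n x then 1 else 0)"

text \<open>The inverse of the basis matrix: to find the coefficients of a function, subtract from its values
  first the value at \<open>a\<close> everywhere except at \<open>a\<close>, and then, at each vertex of rank 5, the new value at
  its partner.\<close>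

definition sd_basis_inv :: "nat \<Rightarrow> nat \<times> bool \<Rightarrow> nat \<times> bool \<Rightarrow> real" where
  "sd_basis_inv n x y = (if x = y then 1 else 0) - (if x \<noteq> (1, False) \<and> y = (1, False) then 1 else 0)
    - (if sd_rank n x = 5 then (if y = sd_partner n x then 1 else 0) - (if y = (1, False) then 1 else 0)
       else 0)"

text \<open>Column \<open>y\<close> lists the coefficients of the image under the Laplacian of the basis function that
  belongs to \<open>y\<close>, as displayed at the beginning.\<close>

definition sd_triangular :: "nat \<Rightarrow> nat \<times> bool \<Rightarrow> nat \<times> bool \<Rightarrow> real" where
  "sd_triangular n x y = (let s = sd_rank n x; r = sd_rank n y in
     if x = y then sd_eigenvalue n r
     else if r \<in> {1, 3, 6} \<and> s = 0 then - 1
     else if r = 2 \<and> s = 1 then - 1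
     else if r = 3 \<and> s = 2 then 1
     else if r = 4 \<and> s \<in> {1, 3} then - 2
     else if r = 5 \<and> (s \<in> {1, 3} \<or> x = sd_partner n y) then - 1
     else if r = 6 \<and> s \<in> {2, 4} then 1
     else 0)"

lemma sd_rank_partner:
  assumes "x \<in> sd_index n" "sd_rank n x = 5"
  shows "sd_rank n (sd_partner n x) = 4"
  using assms by (cases x) (auto simp: sd_rank_def sd_partner_def sd_index_def split: if_splits)

lemma sd_triangular_imp_rank_less:
  assumes "sd_triangular n x y \<noteq> 0" "y \<in> sd_index n"
  shows "x = y \<or> sd_rank n x < sd_rank n y"
  using assms(1) sd_rank_partner[OF assms(2)]
  by (auto simp: sd_triangular_def Let_def split: if_splits)

text \<open>The basis matrix has at most three nonzero entries in each row. Multiplying by it therefore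
  costs no summation over the group, and the matrix identities below reduce to finitely many cases
  for a pair of vertices.\<close>

lemma sum_sd_basis_row:
  assumes "n \<ge> 2" "x \<in> sd_index n"
  shows "(\<Sum>z\<in>sd_index n. sd_basis n x z * f z)
    = f x + (if x = (1, False) then 0 else f (1, False))
      + (if sd_rank n x = 5 then f (sd_partner n x) else 0)"
proof -
  have "sd_basis n x z * f z = (if x = z then f z else 0)
      + (if (1, False) = z then (if x = (1, False) then 0 else f z) else 0)
      + (if sd_partner n x = z then (if sd_rank n x = 5 then f z else 0) else 0)" for z
    by (auto simp: sd_basis_def)
  moreover have "(1, False) \<in> sd_index n" "sd_partner n x \<in> sd_index n"
    using assms by (auto simp: sd_index_def sd_partner_def)
  ultimately show ?thesis using assms(2) by (simp add: sum.distrib)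
qed

lemma sd_partner_iff:
  assumes "y \<in> sd_index n" "z \<in> sd_index n"
  shows "sd_rank n z = 5 \<and> y = sd_partner n z \<longleftrightarrow> sd_rank n y = 4 \<and> z = (fst y + 2 * n, True)"
  using assms by (cases y; cases z) (auto simp: sd_rank_def sd_partner_def sd_index_def odd_pos)

text \<open>The column of \<open>a\<close> is the constant function, and those of rank 4 are the sums over pairs.\<close>

lemma sum_sd_basis_column:
  assumes "n \<ge> 2" "y \<in> sd_index n"
  shows "(\<Sum>z\<in>sd_index n. f z * sd_basis n z y)
    = (if y = (1, False) then sum f (sd_index n)
       else f y + (if sd_rank n y = 4 then f (fst y + 2 * n, True) else 0))"
proof -
  have "f z * sd_basis n z y = (if y = (1, False) then f z else (if z = y then f z else 0)
      + (if z = (fst y + 2 * n, True) then (if sd_rank n y = 4 then f z else 0) else 0))"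
    if "z \<in> sd_index n" for z
    using sd_partner_iff[OF assms(2) that] by (auto simp: sd_basis_def sd_partner_def)
  moreover have "(fst y + 2 * n, True) \<in> sd_index n" if "sd_rank n y = 4"
    using that by (auto simp: sd_index_def sd_rank_def split: if_splits)
  ultimately show ?thesis using assms(2) by (simp add: sum.distrib)
qed

lemma sd_rank_eq_simps:
  assumes "n \<ge> 2"
  shows "sd_rank n x = 0 \<longleftrightarrow> x = (1, False)" "sd_rank n x = 1 \<longleftrightarrow> x = (0, False)"
    "sd_rank n x = 3 \<longleftrightarrow> x = (2 * n, False)"
  using assms by (cases x; auto simp: sd_rank_def split: if_splits)+

lemma sd_basis_inverse:
  assumes "n \<ge> 2" "x \<in> sd_index n" "y \<in> sd_index n"
  shows "(\<Sum>z\<in>sd_index n. sd_basis n x z * sd_basis_inv n z y) = (if x = y then 1 else 0)"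
proof -
  have "sd_rank n (1, False) = 0" using sd_rank_eq_simps(1)[OF assms(1)] by blast
  moreover have "sd_partner n x \<noteq> (1, False)" by (simp add: sd_partner_def)
  ultimately show ?thesis
    unfolding sum_sd_basis_row[OF assms(1,2)] using sd_rank_partner[OF assms(2)]
    by (cases "sd_rank n x = 5") (auto simp: sd_basis_inv_def)
qed

text \<open>Up to the matching inside the pairs, the entries depend only on the ranks of the two vertices.\<close>

lemma sd_laplacian_rank:
  assumes "n \<ge> 2" "x \<in> sd_index n" "y \<in> sd_index n"
  shows "sd_laplacian n x y = (let r = sd_rank n x; s = sd_rank n y in
    if x = y then [4 * real n, 8 * real n, 2, 6 * real n, 4, 4, 4 * real n] ! r - 1
    else if r = 1 \<or> s = 1 \<or> (r \<in> {0, 3, 6} \<and> s \<in> {0, 3, 6}) \<or> (r = 3 \<and> s \<in> {4, 5})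
      \<or> (s = 3 \<and> r \<in> {4, 5}) \<or> (r = 5 \<and> y = sd_partner n x) \<or> (s = 5 \<and> x = sd_partner n y)
    then - 1 else 0)"
proof (cases "x = y")
  case True
  then show ?thesis
    using assms unfolding sd_laplacian_def card_sd_joined[OF assms(1,2)]
    by (cases x) (auto simp: Let_def sd_rank_def)
next
  case False
  obtain i j i' j' where xy: "x = (i, j)" "y = (i', j')" by fastforce
  show ?thesis
    using False assms unfolding xy
    by (cases j; cases j') (auto simp: Let_def sd_laplacian_def sd_joined_def sd_rank_def
        sd_partner_def sd_index_def)
qed

text \<open>Both products are evaluated by the sparsity of the basis, so that only the entries of
  \<open>sd_laplacian\<close> at \<open>y\<close> and at the second member \<open>?y'\<close> of its pair, and those of \<open>sd_triangular\<close> at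
  \<open>x\<close>, at \<open>a\<close> and at the partner of \<open>x\<close>, remain to be compared for the 49 pairs of ranks.\<close>

lemma sd_laplacian_basis:
  assumes "n \<ge> 2" "x \<in> sd_index n" "y \<in> sd_index n"
  shows "(\<Sum>z\<in>sd_index n. sd_laplacian n x z * sd_basis n z y)
    = (\<Sum>z\<in>sd_index n. sd_basis n x z * sd_triangular n z y)"
proof -
  let ?p = "sd_partner n" and ?k = "(1, False)" and ?y' = "(fst y + 2 * n, True)"
  note simps = sd_rank_eq_simps[OF assms(1)]
  have k: "sd_rank n ?k = 0" by (simp add: simps)
  have y': "?y' \<in> sd_index n" "sd_rank n ?y' = 5" "?p ?y' = y" if "sd_rank n y = 4"
    using that by (cases y; auto simp: sd_index_def sd_rank_def sd_partner_def split: if_splits)+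
  have y'_iff: "x = ?y' \<longleftrightarrow> sd_rank n x = 5 \<and> y = ?p x" if "sd_rank n y = 4"
    using sd_partner_iff[OF assms(3,2)] that by blast
  have p: "sd_rank n (?p x) = 4" if "sd_rank n x = 5"
    using sd_rank_partner[OF assms(2) that] .
  have p_inj: "?p x = ?p y \<longleftrightarrow> x = y" if "sd_rank n x = 5" "sd_rank n y = 5"
    using that by (cases x; cases y) (auto simp: sd_partner_def sd_rank_def split: if_splits)
  have Ly': "sd_laplacian n x ?y' = (if sd_rank n x = 5 \<and> y = ?p x then 3
      else if sd_rank n x \<in> {1, 3} \<or> x = y then - 1 else 0)" if y4: "sd_rank n y = 4"
  proof -
    note y' = y'[OF y4]
    have "?y' \<noteq> ?p x" if "sd_rank n x = 5" using p[OF that] y'(2) by auto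
    then show ?thesis
      unfolding sd_laplacian_rank[OF assms(1,2) y'(1)] y'(2,3) Let_def
      using y4 by (auto simp: y'_iff[OF y4])
  qed
  have Tk: "sd_triangular n ?k y = (if sd_rank n y \<in> {1, 3, 6} then - 1 else 0)"
    using k simps(1)[of y] by (auto simp: sd_triangular_def sd_eigenvalue_def sd_partner_def Let_def)
  have Tp: "sd_triangular n (?p x) y = (if y = ?p x then 2 else if x = y then - 1
      else if sd_rank n y = 6 then 1 else 0)" if "sd_rank n x = 5"
    using p[OF that] p_inj[OF that] that
    by (auto simp: sd_triangular_def sd_eigenvalue_def Let_def)
  have k_iff: "x = ?k \<longleftrightarrow> sd_rank n x = 0" "y = ?k \<longleftrightarrow> sd_rank n y = 0"
    by (simp_all only: simps)
  have p_neq: "y \<noteq> ?p x" if "sd_rank n x = 5" "sd_rank n y \<noteq> 4"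
    using p[OF that(1)] that(2) by auto
  have ranks: "sd_rank n x \<in> {0, 1, 2, 3, 4, 5, 6}" "sd_rank n y \<in> {0, 1, 2, 3, 4, 5, 6}"
    by (auto simp: sd_rank_def)
  have "(if sd_rank n y = 0 then 0
        else sd_laplacian n x y + (if sd_rank n y = 4 then sd_laplacian n x ?y' else 0))
      = sd_triangular n x y + (if sd_rank n x = 0 then 0 else sd_triangular n ?k y)
        + (if sd_rank n x = 5 then sd_triangular n (?p x) y else 0)"
  proof (cases "x = y")
    case True
    with ranks(1) show ?thesis
      unfolding sd_laplacian_rank[OF assms] sd_triangular_def[of n x y] Tk Let_def
      using Tp Ly' p_neq by (elim insertE emptyE) (simp_all add: sd_eigenvalue_def)
  next
    case False
    have Tp': "sd_triangular n (?p x) y = (if sd_rank n y = 4 \<and> y = ?p x then 2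
        else if sd_rank n y = 6 then 1 else 0)" if "sd_rank n x = 5"
      using Tp[OF that] p_neq[OF that] False by auto
    have Ly'': "sd_laplacian n x ?y' = (if sd_rank n x = 5 \<and> y = ?p x then 3
      else if sd_rank n x \<in> {1, 3} then - 1 else 0)" if "sd_rank n y = 4"
      using Ly'[OF that] False by simp
    show ?thesis
      unfolding sd_laplacian_rank[OF assms] sd_triangular_def[of n x y] Tk Let_def if_not_P[OF False]
      using ranks by (elim insertE emptyE) (simp_all add: Tp' Ly'' p_neq del: One_nat_def)
  qed
  then show ?thesis
    unfolding sum_sd_basis_row[OF assms(1,2)] sum_sd_basis_column[OF assms(1,3)]
      sum_sd_laplacian[OF assms(2)] k_iff .
qed

lemma prod_sd_eigenvalue:
  assumes "n \<ge> 2"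
  shows "(\<Prod>x\<in>sd_index n. [:- sd_eigenvalue n (sd_rank n x), 1:]) =
    [:0, 1:] * [:- (8 * real n), 1:] * [:- (6 * real n), 1:] * [:- (4 * real n), 1:] ^ (4 * n - 3)
      * [:- 2, 1:] ^ n * [:- 4, 1:] ^ n * [:- 1, 1:] ^ (2 * n)"
proof -
  let ?S = "\<lambda>r. {x \<in> sd_index n. sd_rank n x = r}"
  let ?h = "\<lambda>r. [:- sd_eigenvalue n r, 1:]"
  have "(\<Prod>x\<in>sd_index n. ?h (sd_rank n x)) = (\<Prod>r<7. \<Prod>x\<in>?S r. ?h (sd_rank n x))"
    by (rule prod.group[symmetric]) (auto simp: sd_rank_def)
  also have "\<dots> = (\<Prod>r<7. ?h r ^ card (?S r))"
    by (intro prod.cong HOL.refl) simp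
  also have "\<dots> = ?h 0 ^ card (?S 0) * ?h 1 ^ card (?S 1) * ?h 2 ^ card (?S 2) * ?h 3 ^ card (?S 3)
      * ?h 4 ^ card (?S 4) * ?h 5 ^ card (?S 5) * ?h 6 ^ card (?S 6)"
    by (simp add: eval_nat_numeral)
  finally have prod: "(\<Prod>x\<in>sd_index n. ?h (sd_rank n x)) = \<dots>" .
  have "?S 0 = {(1, False)}" "?S 1 = {(0, False)}" "?S 3 = {(2 * n, False)}"
    using assms by (auto simp: sd_rank_def sd_index_def split: if_splits)
  moreover have "?S 2 = (\<lambda>k. (2 * k, True)) ` {..<2 * n}"
    by (auto simp: sd_rank_def sd_index_def split: if_splits elim!: evenE)
  moreover have "?S 4 = (\<lambda>k. (2 * k + 1, True)) ` {..<n}"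
    by (auto simp: sd_rank_def sd_index_def split: if_splits elim!: oddE)
  moreover have "?S 5 = (\<lambda>k. (2 * k + 1, True)) ` {n..<2 * n}"
    by (auto simp: sd_rank_def sd_index_def split: if_splits elim!: oddE)
  moreover have "?S 6 = ({..<4 * n} - {0, 1, 2 * n}) \<times> {False}"
    by (auto simp: sd_rank_def sd_index_def split: if_splits)
  moreover have "card ({..<4 * n} - {0, 1, 2 * n}) = 4 * n - 3"
    using assms by (subst card_Diff_subset) auto
  ultimately have "card (?S 0) = 1" "card (?S 1) = 1" "card (?S 2) = 2 * n" "card (?S 3) = 1"
    "card (?S 4) = n" "card (?S 5) = n" "card (?S 6) = 4 * n - 3"
    by (simp_all only: card_cartesian_product) (simp_all add: card_image inj_on_def)
  moreover have "sd_eigenvalue n 0 = 0" "sd_eigenvalue n 1 = 8 * real n" "sd_eigenvalue n 2 = 1"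
    "sd_eigenvalue n 3 = 6 * real n" "sd_eigenvalue n 4 = 2" "sd_eigenvalue n 5 = 4"
    "sd_eigenvalue n 6 = 4 * real n"
    by (simp_all add: sd_eigenvalue_def)
  ultimately show ?thesis
    unfolding prod by (simp only: power_one_right minus_zero mult_1 mult_ac)
qed

theorem theorem4p1:
  fixes n :: nat and vs :: "sd_gen word set list"
  assumes "n \<ge> 2"
    and "distinct vs" and "set vs = pverts (enhanced_power_graph (SD n))"
  shows "char_poly (laplacian_matrix (enhanced_power_graph (SD n)) vs) =
    [:0, 1:] * [:- (8 * real n), 1:] * [:- (6 * real n), 1:] * [:- (4 * real n), 1:] ^ (4 * n - 3)
      * [:- 2, 1:] ^ n * [:- 4, 1:] ^ n * [:- 1, 1:] ^ (2 * n)"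
proof -
  have n: "n \<ge> 1" using assms(1) by simp
  note bij = bij_betw_sd_elt[OF n]
  define xs where "xs = map (inv_into (sd_index n) (sd_elt n)) vs"
  have vs: "set vs = carrier (SD n)" using assms(3) by (simp add: enhanced_power_graph_def)
  have bij': "bij_betw (inv_into (sd_index n) (sd_elt n)) (set vs) (sd_index n)"
    using bij_betw_inv_into[OF bij] by (simp add: vs)
  have xs: "distinct xs" "set xs = sd_index n"
    using assms(2) bij' by (simp_all add: xs_def distinct_map bij_betw_def)
  have "map (sd_elt n) xs = vs"
    unfolding xs_def map_map comp_def
    by (rule map_idI) (simp add: vs bij_betw_inv_into_right[OF bij])
  then have "char_poly (laplacian_matrix (enhanced_power_graph (SD n)) vs) =
      char_poly (mat (length xs) (length xs) (\<lambda>(p, q). sd_laplacian n (xs ! p) (xs ! q)))"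
    using laplacian_matrix_SD[OF n xs] by simp
  also have "\<dots> = (\<Prod>x\<in>set xs. [:- sd_triangular n x x, 1:])"
    by (rule char_poly_triangular_basis[where B = "sd_basis n" and C = "sd_basis_inv n" and r = "sd_rank n"])
      (use xs assms(1) in \<open>auto simp: sd_basis_inverse sd_laplacian_basis
        dest: sd_triangular_imp_rank_less\<close>)
  also have "\<dots> = (\<Prod>x\<in>sd_index n. [:- sd_eigenvalue n (sd_rank n x), 1:])"
    by (simp add: xs(2) sd_triangular_def Let_def)
  finally show ?thesis using prod_sd_eigenvalue[OF assms(1)] by simp
qed

end
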